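(* The pattern pairs $(2413,4213)$ and $(2431,4231)$ are $(\mathrm{LMAXP},\mathsf{comp})$-Wilf-equivalent. In particular, $(2413,4213)$ and $(2431,4231)$ are $(\mathsf{lmax},\mathsf{iar},\mathsf{comp})$-Wilf-equivalent; hence $(2431,4231)$ is $\mathsf{iar}$-Wilf-equivalent and also $(\mathsf{iar},\mathsf{comp})$-Wilf-equivalent to $(2413,4213)$.
   Context: $\mathfrak{S}_n$ is the set of permutations $\pi=\pi(1)\cdots\pi(n)$ of $[n]=\{1,\dots,n\}$. A permutation $\pi\in\mathfrak{S}_n$ contains the pattern $\sigma\in\mathfrak{S}_k$ if there are $j_1<\cdots<j_k$ such that $\pi(j_a)<\pi(j_b)$ if and only if $\sigma(a)<\sigma(b)$ for all $1\le a<b\le k$; otherwise it avoids $\sigma$. For a pair $P$ of patterns, $\mathfrak{S}_n(P)$ is the set of $\pi\in\mathfrak{S}_n$ avoiding both patterns. For $\pi\in\mathfrak{S}_n$: $\mathrm{LMAXP}(\pi)=\{i\in[n]:\pi(j)<\pi(i)\text{ for all }1\le j<i\}$ is the set of positions of left-to-right maxima and $\mathsf{lmax}(\pi)=|\mathrm{LMAXP}(\pi)|$; $\mathsf{iar}(\pi)$ is the smallest $i\in[n-1]$ with $\pi(i)>\pi(i+1)$, or $n$ if there is no such $i$; $\mathsf{comp}(\pi)=|\{i\in[n]:\pi(j)\le i\text{ for all }j\le i\}|$. For a (tuple of possibly set-valued) statistic(s) $\mathsf{st}$, two pairs $P,Q$ are $\mathsf{st}$-Wilf-equivalent if for all $n\ge1$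 and every value $v$, $|\{\pi\in\mathfrak{S}_n(P):\mathsf{st}(\pi)=v\}|=|\{\pi\in\mathfrak{S}_n(Q):\mathsf{st}(\pi)=v\}|$. *)

theory Defs
  imports "HOL-Combinatorics.Permutations"
begin

text \<open>
  A permutation of \<open>[n]\<close> is a function \<open>\<pi>\<close> with \<open>\<pi> permutes {1..n}\<close>: positions and values are
  1-based, and \<open>\<pi>\<close> is the identity outside \<open>{1..n}\<close>, so \<open>n\<close> is passed along explicitly.
  A pattern of length \<open>k\<close> is given in one-line notation by the list of its \<open>k\<close> values;
  list positions are 0-based, so \<open>\<sigma> ! a\<close> is the value usually written \<open>\<sigma>(a + 1)\<close>.
\<close>

definition contains_pattern :: "nat \<Rightarrow> (nat \<Rightarrow> nat) \<Rightarrow> nat list \<Rightarrow> bool" where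
  "contains_pattern n \<pi> \<sigma> \<longleftrightarrow>
     (\<exists>j :: nat \<Rightarrow> nat. strict_mono_on {..<length \<sigma>} j \<and> j ` {..<length \<sigma>} \<subseteq> {1..n} \<and>
        (\<forall>a b. a < b \<and> b < length \<sigma> \<longrightarrow> (\<pi> (j a) < \<pi> (j b) \<longleftrightarrow> \<sigma> ! a < \<sigma> ! b)))"

definition avoiders :: "nat \<Rightarrow> nat list \<times> nat list \<Rightarrow> (nat \<Rightarrow> nat) set" where
  "avoiders n P = {\<pi>. \<pi> permutes {1..n} \<and>
     \<not> contains_pattern n \<pi> (fst P) \<and> \<not> contains_pattern n \<pi> (snd P)}"

definition LMAXP :: "nat \<Rightarrow> (nat \<Rightarrow> nat) \<Rightarrow> nat set" where
  "LMAXP n \<pi> = {i \<in> {1..n}. \<forall>j. 1 \<le> j \<and> j < i \<longrightarrow> \<pi> j < \<pi> i}"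

definition lmax :: "nat \<Rightarrow> (nat \<Rightarrow> nat) \<Rightarrow> nat" where
  "lmax n \<pi> = card (LMAXP n \<pi>)"

definition iar :: "nat \<Rightarrow> (nat \<Rightarrow> nat) \<Rightarrow> nat" where
  "iar n \<pi> =
     (if \<exists>i\<in>{1..n - 1}. \<pi> i > \<pi> (i + 1)
      then LEAST i. i \<in> {1..n - 1} \<and> \<pi> i > \<pi> (i + 1) else n)"

definition comps :: "nat \<Rightarrow> (nat \<Rightarrow> nat) \<Rightarrow> nat" where
  "comps n \<pi> = card {i \<in> {1..n}. \<forall>j\<in>{1..i}. \<pi> j \<le> i}"

text \<open>
  A statistic takes the size \<open>n\<close> and the permutation; the value type is arbitrary, so tuples
  of possibly set-valued statistics are covered.
\<close>

definition wilf_equivalent ::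
  "(nat \<Rightarrow> (nat \<Rightarrow> nat) \<Rightarrow> 'v) \<Rightarrow> nat list \<times> nat list \<Rightarrow> nat list \<times> nat list \<Rightarrow> bool" where
  "wilf_equivalent st P Q \<longleftrightarrow>
     (\<forall>n\<ge>1. \<forall>v. card {\<pi> \<in> avoiders n P. st n \<pi> = v} = card {\<pi> \<in> avoiders n Q. st n \<pi> = v})"

end

theory Submission
  imports Defs
begin

text \<open>
  Read a permutation \<open>\<pi>\<close> from left to right, and let \<open>S\<close> be the set of values used so far. The unused
  values below \<open>Max S\<close> fall into gaps between consecutive elements of \<open>S\<close>. Avoiding 2413 and 4213
  means that the next value is a new maximum or lies in the highest nonempty gap: a value taken
  from a lower gap plays the 1, a later value of a higher gap plays the 3, and the 2 and the 4 are
  used values, in either order. Likewise, avoiding 2431 and 4231 means that the next value is a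
  new maximum or lies in the lowest nonempty gap (\<open>avoiders_2413_4213\<close>, \<open>avoiders_2431_4231\<close>).

  In both classes there is thus, at each step that is not a left-to-right maximum, exactly one gap
  that the next value may be taken from, and taking a value splits this gap in two. The number of
  ways to use up a gap of size \<open>g\<close> is the Catalan number of \<open>g\<close>, because the recursion for Catalan
  numbers is exactly the sum over all splits. New maxima create new gaps, but never affect the old
  ones. Hence the number of permutations whose sequence of running maxima is prescribed is
  the product of the Catalan numbers of the gaps created by the new maxima, whichever
  policy selects the active gap (\<open>card_completions\<close>); so it is the same for both classes.

  The sequence of running maxima determines the set of positions of left-to-right maxima and the
  number of components. The initial ascending run ends just before the first
  position without a left-to-right maximum, so it is determined too.

  Since \<open>\<pi> 0 = 0\<close>, the sets of used values are taken as \<open>\<pi> ` {..k}\<close>. The extra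
  element 0 makes them nonempty and serves as the lower end of the lowest gap.
\<close>

section \<open>Splitting a gap, and Catalan numbers\<close>

fun catalan :: "nat \<Rightarrow> nat" where
  "catalan 0 = 1"
| "catalan (Suc n) = (\<Sum>i\<le>n. catalan i * catalan (n - i))"

text \<open>
  The gap of \<open>S\<close> that ends at \<open>s\<close>: the values strictly between \<open>s\<close> and the element of \<open>S\<close>
  preceding it, or all values below \<open>s\<close> if \<open>s\<close> is the least element. Indexing gaps by their upper ends avoids having to name that predecessor.
\<close>

definition gap :: "nat set \<Rightarrow> nat \<Rightarrow> nat set" where
  "gap S s = {v. v < s \<and> (\<forall>x\<in>S. x < v \<or> s \<le> x)}"

text \<open>
  The number of ways to use up all gaps of \<open>S\<close>, if the policy allows one gap at a time.
\<close>

definition gap_weight :: "nat set \<Rightarrow> nat" where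
  "gap_weight S = (\<Prod>s\<in>S. catalan (card (gap S s)))"

lemma gap_notin: "v \<in> gap S s \<Longrightarrow> v \<notin> S"
  by (auto simp: gap_def)

lemma finite_gap [simp]: "finite (gap S s)"
  by (rule finite_subset[of _ "{..<s}"]) (auto simp: gap_def)

text \<open>
  The two cardinalities are the numbers of elements of \<open>G\<close> below and above \<open>v\<close>, so a sum over \<open>v\<close>
  is a sum over ranks. In the induction, a new largest element raises every upper
  count by one, which is why \<open>g\<close> is arbitrary.
\<close>

lemma sum_over_ranks:
  fixes G :: "nat set" and g :: "nat \<Rightarrow> nat \<Rightarrow> nat"
  assumes "finite G"
  shows "(\<Sum>v\<in>G. g (card (G \<inter> {..<v})) (card (G \<inter> {v<..}))) = (\<Sum>i<card G. g i (card G - Suc i))"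
  using assms
proof (induction G arbitrary: g rule: finite_linorder_max_induct)
  case empty
  then show ?case by simp
next
  case (insert b A)
  have b: "b \<notin> A" using insert by auto
  have "(\<Sum>v\<in>A. g (card (insert b A \<inter> {..<v})) (card (insert b A \<inter> {v<..})))
      = (\<Sum>v\<in>A. g (card (A \<inter> {..<v})) (Suc (card (A \<inter> {v<..}))))"
  proof (rule sum.cong[OF refl])
    fix v assume v: "v \<in> A"
    have 1: "insert b A \<inter> {..<v} = A \<inter> {..<v}" using insert.hyps v by force
    have 2: "insert b A \<inter> {v<..} = insert b (A \<inter> {v<..})" using insert.hyps v by force
    show "g (card (insert b A \<inter> {..<v})) (card (insert b A \<inter> {v<..}))
        = g (card (A \<inter> {..<v})) (Suc (card (A \<inter> {v<..})))"
      unfolding 1 2 using b insert.hyps(1) by simp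
  qed
  also have "\<dots> = (\<Sum>i<card A. g i (Suc (card A - Suc i)))"
    using insert.IH[of "\<lambda>i j. g i (Suc j)"] by simp
  also have "\<dots> = (\<Sum>i<card A. g i (card A - i))"
    by (intro sum.cong) (auto simp: Suc_diff_Suc)
  finally have A: "(\<Sum>v\<in>A. g (card (insert b A \<inter> {..<v})) (card (insert b A \<inter> {v<..})))
      = (\<Sum>i<card A. g i (card A - i))" .
  have "insert b A \<inter> {..<b} = A" "insert b A \<inter> {b<..} = {}"
    using insert.hyps by force+
  then show ?case
    using A b insert.hyps(1) by simp
qed

lemma catalan_sum_over_splits:
  fixes G :: "nat set"
  assumes "finite G" "G \<noteq> {}"
  shows "(\<Sum>v\<in>G. catalan (card (G \<inter> {..<v})) * catalan (card (G \<inter> {v<..}))) = catalan (card G)"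
proof -
  obtain n where n: "card G = Suc n"
    using assms by (metis card_gt_0_iff gr0_implies_Suc)
  show ?thesis
    using sum_over_ranks[OF assms(1), of "\<lambda>i j. catalan i * catalan j"]
    by (simp add: n lessThan_Suc_atMost)
qed

text \<open>
  A value from the gap at \<open>s\<close> leaves its smaller part as the gap at \<open>v\<close> and its larger part as the
  gap at \<open>s\<close>, and touches no other gap.
\<close>

lemma gap_weight_split:
  assumes S: "finite S" "s \<in> S" and v: "v \<in> gap S s"
  shows "gap_weight (insert v S) =
    catalan (card (gap S s \<inter> {..<v})) * catalan (card (gap S s \<inter> {v<..}))
    * (\<Prod>t\<in>S - {s}. catalan (card (gap S t)))"
proof -
  have vS: "v \<notin> S" using v by (rule gap_notin)
  have below: "gap (insert v S) v = gap S s \<inter> {..<v}"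
    using v S by (fastforce simp: gap_def)
  have above: "gap (insert v S) s = gap S s \<inter> {v<..}"
    using v S by (fastforce simp: gap_def)
  have other: "gap (insert v S) t = gap S t" if "t \<in> S - {s}" for t
    using v S that by (fastforce simp: gap_def)
  have "gap_weight (insert v S) = catalan (card (gap (insert v S) v))
      * (catalan (card (gap (insert v S) s)) * (\<Prod>t\<in>S - {s}. catalan (card (gap (insert v S) t))))"
    unfolding gap_weight_def using S vS by (simp add: prod.remove[of S s])
  also have "(\<Prod>t\<in>S - {s}. catalan (card (gap (insert v S) t)))
      = (\<Prod>t\<in>S - {s}. catalan (card (gap S t)))"
    using other by (intro prod.cong) auto
  finally show ?thesis
    by (simp add: below above)
qed

text \<open>
  The heart of the count: the Catalan recursion makes the weight invariant under a step in
  any one nonempty gap, and the result does not depend on which gap it was.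
\<close>

lemma sum_gap_weight_insert:
  assumes "finite S" "s \<in> S" "gap S s \<noteq> {}"
  shows "(\<Sum>v\<in>gap S s. gap_weight (insert v S)) = gap_weight S"
proof -
  have "(\<Sum>v\<in>gap S s. gap_weight (insert v S)) =
     (\<Sum>v\<in>gap S s. catalan (card (gap S s \<inter> {..<v})) * catalan (card (gap S s \<inter> {v<..})))
      * (\<Prod>t\<in>S - {s}. catalan (card (gap S t)))"
    using assms by (simp add: gap_weight_split sum_distrib_right)
  also have "\<dots> = gap_weight S"
    using assms by (simp add: catalan_sum_over_splits gap_weight_def prod.remove[of S s])
  finally show ?thesis .
qed

lemma gap_weight_new_max:
  assumes S: "finite S" "S \<noteq> {}" and v: "Max S < v"
  shows "gap_weight (insert v S) = catalan (v - Max S - 1) * gap_weight S"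
proof -
  have lt: "x < v" if "x \<in> S" for x
    using that S v by (meson Max_ge le_less_trans)
  then have vS: "v \<notin> S" by blast
  have "gap (insert v S) v = {u. u < v \<and> (\<forall>x\<in>S. x < u)}"
    using lt by (fastforce simp: gap_def)
  also have "\<dots> = {Max S<..<v}" using Max_less_iff[OF S] by auto
  finally have "gap (insert v S) v = {Max S<..<v}" .
  moreover have "gap (insert v S) t = gap S t" if "t \<in> S" for t
    using lt[OF that] by (auto simp: gap_def)
  then have "(\<Prod>t\<in>S. catalan (card (gap (insert v S) t))) = gap_weight S"
    unfolding gap_weight_def by (intro prod.cong) auto
  ultimately show ?thesis
    using S vS by (simp add: gap_weight_def)
qed

lemma gap_weight_atMost: "gap_weight {..n} = 1"
proof -
  have "gap {..n} s = {}" if "s \<le> n" for s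
    using that by (force simp: gap_def)
  then show ?thesis by (simp add: gap_weight_def)
qed

section \<open>Running maxima\<close>

definition run_max :: "(nat \<Rightarrow> nat) \<Rightarrow> nat \<Rightarrow> nat" where
  "run_max \<pi> k = Max (\<pi> ` {..k})"

lemma run_max_Suc: "run_max \<pi> (Suc k) = max (\<pi> (Suc k)) (run_max \<pi> k)"
  by (simp add: run_max_def atMost_Suc)

lemma mono_run_max: "mono (run_max \<pi>)"
  by (simp add: mono_iff_le_Suc run_max_Suc)

lemma permutes_zero: "\<pi> permutes {1..n} \<Longrightarrow> \<pi> 0 = (0::nat)"
  by (simp add: permutes_not_in)

text \<open>
  Pigeonhole: \<open>k + 1\<close> distinct values cannot all be below \<open>k\<close>. This is what guarantees a nonempty
  gap at every step without a new maximum.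
\<close>

lemma run_max_ge:
  assumes "inj (\<pi> :: nat \<Rightarrow> nat)"
  shows "k \<le> run_max \<pi> k"
proof -
  have "\<pi> ` {..k} \<subseteq> {..run_max \<pi> k}"
    by (auto simp: run_max_def)
  from card_mono[OF _ this] show ?thesis
    using assms by (simp add: card_image inj_on_subset)
qed

lemma run_max_beyond:
  assumes "\<pi> permutes {1..n}" "n \<le> k"
  shows "run_max \<pi> k = k"
proof -
  have "\<pi> permutes {..k}"
    using assms by (auto intro: permutes_subset)
  then show ?thesis
    unfolding run_max_def by (simp only: permutes_image) (auto intro: Max_eqI)
qed

section \<open>Gap-filling rules\<close>

text \<open>
  A rule \<open>adm\<close> tells which values \<open>v\<close> may follow a prefix with value set \<open>S\<close>. It is gap-filling if it
  admits every new maximum and, as long as some gap is nonempty, exactly one nonempty gap besides.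
\<close>

definition gap_filling :: "(nat set \<Rightarrow> nat \<Rightarrow> bool) \<Rightarrow> bool" where
  "gap_filling adm \<longleftrightarrow>
     (\<forall>S. finite S \<and> 0 \<in> S \<longrightarrow>
        (\<forall>v. adm S v \<longrightarrow> v \<notin> S) \<and> (\<forall>v>Max S. adm S v) \<and>
        ((\<exists>y<Max S. y \<notin> S) \<longrightarrow>
           (\<exists>s\<in>S. gap S s \<noteq> {} \<and> (\<forall>v<Max S. adm S v \<longleftrightarrow> v \<in> gap S s))))"

lemma gap_fillingD:
  assumes "gap_filling adm" "finite S" "0 \<in> S"
  shows "adm S v \<Longrightarrow> v \<notin> S" "Max S < v \<Longrightarrow> adm S v"
    "\<exists>y<Max S. y \<notin> S \<Longrightarrow> \<exists>s\<in>S. gap S s \<noteq> {} \<and> (\<forall>v<Max S. adm S v \<longleftrightarrow> v \<in> gap S s)"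
  using assms by (simp_all add: gap_filling_def)

definition rule_perms :: "(nat set \<Rightarrow> nat \<Rightarrow> bool) \<Rightarrow> nat \<Rightarrow> (nat \<Rightarrow> nat) set" where
  "rule_perms adm n = {\<pi>. \<pi> permutes {1..n} \<and> (\<forall>k<n. adm (\<pi> ` {..k}) (\<pi> (Suc k)))}"

text \<open>
  What is needed of the values of \<open>f\<close> on \<open>{..k}\<close> for it to be the beginning of a permutation of
  \<open>{1..n}\<close> that obeys the rule and has running maxima \<open>m\<close>.
\<close>

definition prefix_ok :: "(nat set \<Rightarrow> nat \<Rightarrow> bool) \<Rightarrow> nat \<Rightarrow> (nat \<Rightarrow> nat) \<Rightarrow> nat \<Rightarrow> (nat \<Rightarrow> nat) \<Rightarrow> bool" where
  "prefix_ok adm n m k f \<longleftrightarrow> f 0 = 0 \<and> inj_on f {..k} \<and> f ` {..k} \<subseteq> {..n} \<and>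
     (\<forall>j\<le>k. run_max f j = m j) \<and> (\<forall>j<k. adm (f ` {..j}) (f (Suc j)))"

definition completions :: "(nat set \<Rightarrow> nat \<Rightarrow> bool) \<Rightarrow> nat \<Rightarrow> (nat \<Rightarrow> nat) \<Rightarrow> nat \<Rightarrow> (nat \<Rightarrow> nat) \<Rightarrow> (nat \<Rightarrow> nat) set" where
  "completions adm n m k f = {\<pi> \<in> rule_perms adm n. run_max \<pi> = m \<and> (\<forall>i\<le>k. \<pi> i = f i)}"

lemma finite_completions: "finite (completions adm n m k f)"
  by (rule finite_subset[OF _ finite_permutations[of "{1..n}"]])
    (auto simp: completions_def rule_perms_def)

lemma completions_Suc:
  "completions adm n m (Suc k) (f(Suc k := v)) = {\<pi> \<in> completions adm n m k f. \<pi> (Suc k) = v}"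
  by (auto simp: completions_def le_Suc_eq)

lemma image_upd_atMost: "j \<le> k \<Longrightarrow> f(Suc k := v) ` {..j} = f ` {..j}"
  by (rule image_cong) auto

lemma image_upd_atMost_Suc: "f(Suc k := v) ` {..Suc k} = insert v (f ` {..k})"
  unfolding atMost_Suc image_insert image_upd_atMost[OF order_refl] by simp

lemma prefix_ok_Suc:
  assumes ok: "prefix_ok adm n m k f"
    and v: "v \<notin> f ` {..k}" "v \<le> n" "adm (f ` {..k}) v" "max v (m k) = m (Suc k)"
  shows "prefix_ok adm n m (Suc k) (f(Suc k := v))"
proof -
  let ?g = "f(Suc k := v)"
  have img: "?g ` {..j} = f ` {..j}" if "j \<le> k" for j
    using that by (rule image_upd_atMost)
  have rm: "run_max ?g j = m j" if "j \<le> k" for j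
    using ok img[OF that] that by (simp add: run_max_def prefix_ok_def)
  have "run_max ?g (Suc k) = m (Suc k)"
    using rm[of k] v by (simp add: run_max_Suc)
  with rm have 1: "\<forall>j\<le>Suc k. run_max ?g j = m j"
    by (auto simp: le_Suc_eq)
  have 2: "inj_on ?g {..Suc k}"
    using ok v img[of k] unfolding atMost_Suc inj_on_insert
    by (auto simp: prefix_ok_def inj_on_def)
  have 3: "?g ` {..Suc k} \<subseteq> {..n}"
    using ok v by (auto simp: prefix_ok_def le_Suc_eq image_subset_iff)
  have 4: "adm (?g ` {..j}) (?g (Suc j))" if "j < Suc k" for j
    unfolding img[OF less_Suc_eq_le[THEN iffD1, OF that]]
    using ok v that by (auto simp: prefix_ok_def less_Suc_eq)
  show ?thesis
    using 1 2 3 4 ok by (simp add: prefix_ok_def)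
qed

text \<open>
  A prefix of full length has only itself as a completion, once its values beyond \<open>n\<close> are reset to
  the identity; and it has no gaps left.
\<close>

lemma completions_full:
  assumes ok: "prefix_ok adm n m n f" and m: "\<And>k. n \<le> k \<Longrightarrow> m k = k"
  shows "card (completions adm n m n f) = 1" "gap_weight (f ` {..n}) = 1"
proof -
  have im: "f ` {..n} = {..n}"
    using ok by (intro endo_inj_surj) (auto simp: prefix_ok_def)
  then show "gap_weight (f ` {..n}) = 1" by (simp add: gap_weight_atMost)
  define g where "g = (\<lambda>i. if i \<le> n then f i else i)"
  have gi: "g ` {..j} = f ` {..j}" if "j \<le> n" for j
    using that by (intro image_cong) (auto simp: g_def)
  have inj: "inj_on g {..n}"
    using ok by (auto simp: prefix_ok_def g_def inj_on_def)
  have "bij_betw g {..n} {..n}"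
    using inj gi[of n] im by (simp add: bij_betw_def)
  then have "g permutes {..n}"
    by (rule bij_imp_permutes) (auto simp: g_def)
  then have perm: "g permutes {1..n}"
  proof (rule permutes_superset)
    fix x assume "x \<in> {..n} - {1..n}"
    then have "x = 0" by auto
    then show "g x = x" using ok by (simp add: g_def prefix_ok_def)
  qed
  have "run_max g j = m j" for j
  proof (cases "j \<le> n")
    case True
    then show ?thesis using gi ok by (simp add: run_max_def prefix_ok_def)
  next
    case False
    then show ?thesis using m run_max_beyond[OF perm] by simp
  qed
  moreover have "\<forall>k<n. adm (g ` {..k}) (g (Suc k))"
    using ok gi by (simp add: prefix_ok_def g_def)
  ultimately have "g \<in> completions adm n m n f"
    using perm by (auto simp: completions_def rule_perms_def g_def)
  moreover have "\<pi> = g" if "\<pi> \<in> completions adm n m n f" for \<pi>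
  proof
    fix i show "\<pi> i = g i"
      using that by (cases "i \<le> n") (auto simp: completions_def rule_perms_def g_def permutes_def)
  qed
  ultimately have "completions adm n m n f = {g}" by blast
  then show "card (completions adm n m n f) = 1" by simp
qed

text \<open>
  Backward induction on the length of the prefix. A step with a new maximum is forced and
  opens one gap, whose Catalan number is the next factor of the product. Any other step
  chooses freely from the gap that the rule selects, and the weights of the outcomes add up to the
  weight before the step. The formula does not mention the rule. The permutation \<open>\<rho>\<close> only
  ensures that \<open>m\<close> is a possible sequence of running maxima.
\<close>

lemma card_completions:
  assumes rule: "gap_filling adm" and \<rho>: "\<rho> permutes {1..n}" and m: "m = run_max \<rho>"
    and "k \<le> n" "prefix_ok adm n m k f"
  shows "card (completions adm n m k f) = gap_weight (f ` {..k}) *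
    (\<Prod>i\<in>{k..<n}. if m i < m (Suc i) then catalan (m (Suc i) - m i - 1) else 1)"
  using \<open>k \<le> n\<close> \<open>prefix_ok adm n m k f\<close>
proof (induction k arbitrary: f rule: inc_induct)
  case base
  have "m k = k" if "n \<le> k" for k
    using run_max_beyond[OF \<rho> that] by (simp add: m)
  from completions_full[OF base this] show ?case by simp
next
  case (step k)
  let ?S = "f ` {..k}"
  let ?w = "\<lambda>i. if m i < m (Suc i) then catalan (m (Suc i) - m i - 1) else 1"
  have fin: "finite ?S" and zero: "0 \<in> ?S"
    using step.prems by (auto simp: prefix_ok_def intro!: image_eqI[of _ _ 0])
  have Max: "Max ?S = m k"
    using step.prems by (simp add: prefix_ok_def run_max_def)
  have card: "card ?S = Suc k"
    using step.prems by (simp add: prefix_ok_def card_image)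
  have mono: "mono m" by (simp add: m mono_run_max)
  have mn: "m (Suc k) \<le> n"
    using monoD[OF mono, of "Suc k" n] step.hyps run_max_beyond[OF \<rho>, of n] by (simp add: m)
  have ge: "Suc k \<le> m (Suc k)"
    unfolding m using \<rho> by (intro run_max_ge) (rule permutes_inj)
  have prod: "(\<Prod>i\<in>{k..<n}. ?w i) = ?w k * (\<Prod>i\<in>{Suc k..<n}. ?w i)"
    using step.hyps by (simp add: prod.atLeast_Suc_lessThan)
  have next_max: "max (\<pi> (Suc k)) (m k) = m (Suc k)"
    and next_adm: "adm ?S (\<pi> (Suc k))" if "\<pi> \<in> completions adm n m k f" for \<pi>
  proof -
    have "\<pi> ` {..k} = ?S" using that by (intro image_cong) (auto simp: completions_def)
    then show "adm ?S (\<pi> (Suc k))"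
      using that step.hyps by (auto simp: completions_def rule_perms_def)
    show "max (\<pi> (Suc k)) (m k) = m (Suc k)"
      using that run_max_Suc[of \<pi> k] by (auto simp: completions_def)
  qed
  have notin: "v \<notin> ?S" if "adm ?S v" for v
    using that gap_fillingD(1)[OF rule fin zero] by simp
  show ?case
  proof (cases "m k < m (Suc k)")
    case True
    let ?v = "m (Suc k)"
    have adm: "adm ?S ?v"
      using gap_fillingD(2)[OF rule fin zero] Max True by simp
    have "prefix_ok adm n m (Suc k) (f(Suc k := ?v))"
      using True adm notin mn by (intro prefix_ok_Suc step.prems) auto
    note IH = step.IH[OF this]
    have "completions adm n m k f = completions adm n m (Suc k) (f(Suc k := ?v))"
      unfolding completions_Suc using next_max True by (force simp: max_def split: if_splits)
    moreover have "f(Suc k := ?v) ` {..Suc k} = insert ?v ?S"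
      by (rule image_upd_atMost_Suc)
    moreover have "gap_weight (insert ?v ?S) = catalan (?v - m k - 1) * gap_weight ?S"
      unfolding Max[symmetric] using zero True Max by (intro gap_weight_new_max fin) auto
    ultimately show ?thesis
      unfolding prod using IH True by (simp del: fun_upd_apply)
  next
    case False
    then have eq: "m (Suc k) = m k"
      using monoD[OF mono, of k "Suc k"] by simp
    \<comment> \<open>Only \<open>k + 1\<close> values are used, but the maximum is at least \<open>k + 1\<close>, and 0 counts as a value.\<close>
    have "\<exists>y<Max ?S. y \<notin> ?S"
    proof (rule ccontr)
      assume "\<not> ?thesis"
      then have "{..<m k} \<subseteq> ?S" by (auto simp: Max)
      moreover have "m k \<in> ?S" using Max_in[OF fin] zero Max by auto
      ultimately have "{..m k} \<subseteq> ?S"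
        unfolding ivl_disj_un_singleton(2)[symmetric] by blast
      from card_mono[OF fin this] show False
        using ge eq card by simp
    qed
    then obtain s where s: "s \<in> ?S" "gap ?S s \<noteq> {}"
      and adm: "\<And>v. v < m k \<Longrightarrow> adm ?S v \<longleftrightarrow> v \<in> gap ?S s"
      using gap_fillingD(3)[OF rule fin zero] unfolding Max by metis
    have "s \<le> m k" using Max_ge[OF fin s(1)] Max by simp
    then have gap_less: "v < m k" if "v \<in> gap ?S s" for v
      using that by (simp add: gap_def)
    have "completions adm n m k f = (\<Union>v\<in>gap ?S s. completions adm n m (Suc k) (f(Suc k := v)))"
      (is "_ = ?U")
    proof (rule equalityI; rule subsetI)
      fix \<pi> assume \<pi>: "\<pi> \<in> completions adm n m k f"
      have "\<pi> (Suc k) \<le> m k" using next_max[OF \<pi>] eq by simp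
      moreover have "\<pi> (Suc k) \<noteq> m k"
        using notin[OF next_adm[OF \<pi>]] Max_in[OF fin] zero Max by auto
      ultimately show "\<pi> \<in> ?U"
        using adm next_adm[OF \<pi>] \<pi> by (auto simp: completions_Suc)
    qed (auto simp: completions_Suc)
    moreover have "card ?U = (\<Sum>v\<in>gap ?S s. card (completions adm n m (Suc k) (f(Suc k := v))))"
      by (intro card_UN_disjoint ballI finite_completions) (auto simp: completions_Suc)
    moreover have "card (completions adm n m (Suc k) (f(Suc k := v)))
        = gap_weight (insert v ?S) * (\<Prod>i\<in>{Suc k..<n}. ?w i)" if v: "v \<in> gap ?S s" for v
    proof -
      have "prefix_ok adm n m (Suc k) (f(Suc k := v))"
        using gap_notin[OF v] adm[of v] gap_less[OF v] v eq mn
        by (intro prefix_ok_Suc step.prems) auto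
      from step.IH[OF this] show ?thesis
        unfolding image_upd_atMost_Suc .
    qed
    ultimately have "card (completions adm n m k f)
        = (\<Sum>v\<in>gap ?S s. gap_weight (insert v ?S)) * (\<Prod>i\<in>{Suc k..<n}. ?w i)"
      by (simp add: sum_distrib_right)
    then show ?thesis
      using sum_gap_weight_insert[OF fin s] eq by (simp add: prod)
  qed
qed

lemma card_rule_perms_run_max:
  assumes "gap_filling adm" "gap_filling adm'" and \<rho>: "\<rho> permutes {1..n}"
  shows "card {\<pi> \<in> rule_perms adm n. run_max \<pi> = run_max \<rho>}
       = card {\<pi> \<in> rule_perms adm' n. run_max \<pi> = run_max \<rho>}"
proof -
  have eq: "{\<pi> \<in> rule_perms adm n. run_max \<pi> = run_max \<rho>} = completions adm n (run_max \<rho>) 0 id" for adm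
    by (auto simp: completions_def rule_perms_def intro: permutes_zero)
  have ok: "prefix_ok adm n (run_max \<rho>) 0 id" for adm
    using permutes_zero[OF \<rho>] by (simp add: prefix_ok_def run_max_def)
  show ?thesis
    unfolding eq card_completions[OF assms(1) \<rho> refl le0 ok] card_completions[OF assms(2) \<rho> refl le0 ok] ..
qed

section \<open>The two pattern classes\<close>

text \<open>
  In both rules \<open>s\<close> and \<open>t\<close> play the 2 and the 4 of the patterns. In the first one \<open>v\<close> plays the 1 and
  \<open>y\<close> the 3, in the second one the roles of \<open>v\<close> and \<open>y\<close> are exchanged.
\<close>

definition top_gap_rule :: "nat set \<Rightarrow> nat \<Rightarrow> bool" where
  "top_gap_rule S v \<longleftrightarrow> v \<notin> S \<and> \<not> (\<exists>s\<in>S. \<exists>t\<in>S. \<exists>y. y \<notin> S \<and> v < s \<and> s < y \<and> y < t)"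

definition bottom_gap_rule :: "nat set \<Rightarrow> nat \<Rightarrow> bool" where
  "bottom_gap_rule S v \<longleftrightarrow> v \<notin> S \<and> \<not> (\<exists>s\<in>S. \<exists>t\<in>S. \<exists>y. y \<notin> S \<and> y < s \<and> s < v \<and> v < t)"

lemma next_used_value:
  assumes "finite S" "y < Max S" "y \<notin> (S :: nat set)" "S \<noteq> {}"
  obtains s where "s \<in> S" "y \<in> gap S s"
proof -
  define s where "s = Min {x\<in>S. y < x}"
  have ne: "{x\<in>S. y < x} \<noteq> {}" using assms Max_in by blast
  have "s \<in> {x\<in>S. y < x}"
    unfolding s_def using assms(1) ne by (intro Min_in) auto
  moreover have "s \<le> x" if "x \<in> S" "y < x" for x
    unfolding s_def using assms(1) that by (intro Min_le) auto
  ultimately show thesis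
    using assms(3) that[of s] by (fastforce simp: gap_def neq_iff)
qed

text \<open>
  The selected gap is the one that contains the largest unused value \<open>y\<close> below the maximum. An
  unused \<open>v\<close> in another gap is separated from \<open>y\<close> by a used value, against the rule.
\<close>

lemma gap_filling_top: "gap_filling top_gap_rule"
  unfolding gap_filling_def
proof (intro allI impI conjI)
  fix S :: "nat set" and v assume S: "finite S \<and> 0 \<in> S"
  show "v \<notin> S" if "top_gap_rule S v" using that by (simp add: top_gap_rule_def)
  show "top_gap_rule S v" if "Max S < v"
    using that S unfolding top_gap_rule_def by (meson Max_ge leD less_trans)
next
  fix S :: "nat set" assume S: "finite S \<and> 0 \<in> S" and ex: "\<exists>y<Max S. y \<notin> S"
  define y where "y = Max {y. y < Max S \<and> y \<notin> S}"
  have "y \<in> {y. y < Max S \<and> y \<notin> S}"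
    unfolding y_def using ex by (intro Max_in) auto
  moreover have le: "x \<le> y" if "x < Max S" "x \<notin> S" for x
    unfolding y_def using that by (intro Max_ge) auto
  ultimately obtain s where s: "s \<in> S" "y \<in> gap S s" and y: "y < Max S" "y \<notin> S"
    using next_used_value[of S y] S by auto
  have "top_gap_rule S v \<longleftrightarrow> v \<in> gap S s" if v: "v < Max S" for v
  proof
    assume v2: "top_gap_rule S v"
    then have "v \<le> y" using le v by (simp add: top_gap_rule_def)
    moreover have "Max S \<in> S" using S by (intro Max_in) auto
    ultimately have "x < v \<or> y \<le> x" if "x \<in> S" for x
      using v2 y that unfolding top_gap_rule_def by (metis linorder_less_linear not_le_imp_less)
    then show "v \<in> gap S s"
      using s \<open>v \<le> y\<close> y unfolding gap_def by fastforce
  next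
    assume v2: "v \<in> gap S s"
    have "False" if "a \<in> S" "t \<in> S" "z \<notin> S" "v < a" "a < z" "z < t" for a t z
    proof -
      have "z < Max S" using that S by (meson Max_ge less_le_trans)
      then have "z \<le> y" using le that by blast
      then show False using v2 that s by (fastforce simp: gap_def)
    qed
    then show "top_gap_rule S v"
      using gap_notin[OF v2] unfolding top_gap_rule_def by blast
  qed
  then show "\<exists>s\<in>S. gap S s \<noteq> {} \<and> (\<forall>v<Max S. top_gap_rule S v \<longleftrightarrow> v \<in> gap S s)"
    using s by blast
qed

text \<open>
  Here the selected gap is the one that contains the smallest unused value.
\<close>

lemma gap_filling_bottom: "gap_filling bottom_gap_rule"
  unfolding gap_filling_def
proof (intro allI impI conjI)
  fix S :: "nat set" and v assume S: "finite S \<and> 0 \<in> S"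
  show "v \<notin> S" if "bottom_gap_rule S v" using that by (simp add: bottom_gap_rule_def)
  show "bottom_gap_rule S v" if "Max S < v"
    using that S unfolding bottom_gap_rule_def by (meson Max_ge leD less_trans)
next
  fix S :: "nat set" assume S: "finite S \<and> 0 \<in> S" and ex: "\<exists>y<Max S. y \<notin> S"
  define y where "y = (LEAST y. y \<notin> S)"
  have y: "y \<notin> S" "y < Max S"
    using ex unfolding y_def by (metis LeastI, metis Least_le le_less_trans)
  have le: "y \<le> x" if "x \<notin> S" for x
    unfolding y_def using that by (rule Least_le)
  obtain s where s: "s \<in> S" "y \<in> gap S s"
    using next_used_value[of S y] S y by auto
  have "bottom_gap_rule S v \<longleftrightarrow> v \<in> gap S s" if v: "v < Max S" for v
  proof
    assume v2: "bottom_gap_rule S v"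
    then have "y \<le> v" using le by (simp add: bottom_gap_rule_def)
    moreover have "Max S \<in> S" using S by (intro Max_in) auto
    ultimately have "\<not> s < v"
      using v2 y v s unfolding bottom_gap_rule_def gap_def by blast
    moreover have "v \<noteq> s" using v2 s by (auto simp: bottom_gap_rule_def)
    ultimately have "v < s" by simp
    moreover have "x < v \<or> s \<le> x" if "x \<in> S" for x
      using s(2) that \<open>y \<le> v\<close> unfolding gap_def by force
    ultimately show "v \<in> gap S s" by (simp add: gap_def)
  next
    assume v2: "v \<in> gap S s"
    have "False" if "a \<in> S" "z \<notin> S" "z < a" "a < v" for a z
      using le[OF that(2)] that v2 s by (fastforce simp: gap_def)
    then show "bottom_gap_rule S v"
      using gap_notin[OF v2] unfolding bottom_gap_rule_def by blast
  qed
  then show "\<exists>s\<in>S. gap S s \<noteq> {} \<and> (\<forall>v<Max S. bottom_gap_rule S v \<longleftrightarrow> v \<in> gap S s)"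
    using s by blast
qed

lemma contains_pattern_4:
  "contains_pattern n \<pi> [w, x, y, z] \<longleftrightarrow>
    (\<exists>a b c d. 1 \<le> a \<and> a < b \<and> b < c \<and> c < d \<and> d \<le> n \<and>
      (\<pi> a < \<pi> b \<longleftrightarrow> w < x) \<and> (\<pi> a < \<pi> c \<longleftrightarrow> w < y) \<and> (\<pi> a < \<pi> d \<longleftrightarrow> w < z) \<and>
      (\<pi> b < \<pi> c \<longleftrightarrow> x < y) \<and> (\<pi> b < \<pi> d \<longleftrightarrow> x < z) \<and> (\<pi> c < \<pi> d \<longleftrightarrow> y < z))"
  (is "_ = ?R")
proof
  assume "contains_pattern n \<pi> [w, x, y, z]"
  then obtain j where j: "strict_mono_on {..<4} j" "j ` {..<4} \<subseteq> {1..n}"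
    and pat: "\<And>a b. a < b \<Longrightarrow> b < 4 \<Longrightarrow>
      \<pi> (j a) < \<pi> (j b) \<longleftrightarrow> [w, x, y, z] ! a < [w, x, y, z] ! b"
    by (auto simp: contains_pattern_def eval_nat_numeral)
  have "1 \<le> j 0" "j 3 \<le> n" using j(2) by (auto simp: image_subset_iff)
  moreover have "j 0 < j 1" "j 1 < j 2" "j 2 < j 3"
    using j(1) by (auto simp: strict_mono_on_def)
  ultimately show ?R
    using pat[of 0 1] pat[of 0 2] pat[of 0 3] pat[of 1 2] pat[of 1 3] pat[of 2 3]
    by (intro exI[of _ "j 0"] exI[of _ "j 1"] exI[of _ "j 2"] exI[of _ "j 3"])
      (simp add: eval_nat_numeral)
next
  assume ?R
  then obtain a b c d where R: "1 \<le> a" "a < b" "b < c" "c < d" "d \<le> n"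
      "(\<pi> a < \<pi> b \<longleftrightarrow> w < x) \<and> (\<pi> a < \<pi> c \<longleftrightarrow> w < y) \<and> (\<pi> a < \<pi> d \<longleftrightarrow> w < z) \<and>
      (\<pi> b < \<pi> c \<longleftrightarrow> x < y) \<and> (\<pi> b < \<pi> d \<longleftrightarrow> x < z) \<and> (\<pi> c < \<pi> d \<longleftrightarrow> y < z)"
    by blast
  have four: "i < length [w, x, y, z] \<longleftrightarrow> i = 0 \<or> i = 1 \<or> i = 2 \<or> i = 3" for i
    by auto
  show "contains_pattern n \<pi> [w, x, y, z]"
    unfolding contains_pattern_def
  proof (intro exI[of _ "\<lambda>i. [a, b, c, d] ! i"] conjI allI impI)
    show "strict_mono_on {..<length [w, x, y, z]} ((!) [a, b, c, d])"
      using R unfolding strict_mono_on_def lessThan_iff four by (auto simp: eval_nat_numeral)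
    show "(!) [a, b, c, d] ` {..<length [w, x, y, z]} \<subseteq> {1..n}"
      using R by (auto simp: four eval_nat_numeral simp del: list.size)
  next
    fix i k assume "i < k \<and> k < length [w, x, y, z]"
    then have "i = 0 \<and> k = 1 \<or> i = 0 \<and> k = 2 \<or> i = 0 \<and> k = 3 \<or>
        i = 1 \<and> k = 2 \<or> i = 1 \<and> k = 3 \<or> i = 2 \<and> k = 3"
      by auto
    then show "\<pi> ([a, b, c, d] ! i) < \<pi> ([a, b, c, d] ! k)
        \<longleftrightarrow> [w, x, y, z] ! i < [w, x, y, z] ! k"
      using R(6) by (elim disjE) simp_all
  qed
qed

text \<open>
  The two patterns differ only in the order of their first two entries, so the order of the
  positions \<open>a\<close> of the 2 and \<open>b\<close> of the 4 is immaterial.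
\<close>

lemma contains_2413_or_4213:
  assumes "inj \<pi>"
  shows "contains_pattern n \<pi> [2,4,1,3] \<or> contains_pattern n \<pi> [4,2,1,3] \<longleftrightarrow>
    (\<exists>a b p q. 1 \<le> a \<and> 1 \<le> b \<and> a < p \<and> b < p \<and> p < q \<and> q \<le> n \<and> \<pi> p < \<pi> a \<and> \<pi> a < \<pi> q \<and> \<pi> q < \<pi> b)"
    (is "?L = ?R")
proof
  have ne: "\<pi> x = \<pi> y \<longleftrightarrow> x = y" for x y using assms by (simp add: inj_eq)
  assume ?L
  then show ?R
  proof
    assume "contains_pattern n \<pi> [2,4,1,3]"
    then obtain a b c d where "1 \<le> a" "a < b" "b < c" "c < d" "d \<le> n"
      "\<pi> a < \<pi> b" "\<not> \<pi> a < \<pi> c" "\<pi> a < \<pi> d" "\<not> \<pi> b < \<pi> c" "\<not> \<pi> b < \<pi> d" "\<pi> c < \<pi> d"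
      unfolding contains_pattern_4 by auto
    then show ?R
      using ne[of c a] ne[of d b]
      by (intro exI[of _ a] exI[of _ b] exI[of _ c] exI[of _ d]) auto
  next
    assume "contains_pattern n \<pi> [4,2,1,3]"
    then obtain a b c d where "1 \<le> a" "a < b" "b < c" "c < d" "d \<le> n"
      "\<not> \<pi> a < \<pi> b" "\<not> \<pi> a < \<pi> c" "\<not> \<pi> a < \<pi> d" "\<not> \<pi> b < \<pi> c" "\<pi> b < \<pi> d" "\<pi> c < \<pi> d"
      unfolding contains_pattern_4 by auto
    then show ?R
      using ne[of c b] ne[of d a]
      by (intro exI[of _ b] exI[of _ a] exI[of _ c] exI[of _ d]) auto
  qed
next
  assume ?R
  then obtain a b p q where R: "1 \<le> a" "1 \<le> b" "a < p" "b < p" "p < q" "q \<le> n"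
    "\<pi> p < \<pi> a" "\<pi> a < \<pi> q" "\<pi> q < \<pi> b" by blast
  then consider "a < b" | "b < a" by (metis less_trans linorder_neqE_nat less_irrefl)
  then show ?L
  proof cases
    case 1
    then have "contains_pattern n \<pi> [2,4,1,3]"
      unfolding contains_pattern_4 using R
      by (intro exI[of _ a] exI[of _ b] exI[of _ p] exI[of _ q]) auto
    then show ?L ..
  next
    case 2
    then have "contains_pattern n \<pi> [4,2,1,3]"
      unfolding contains_pattern_4 using R
      by (intro exI[of _ b] exI[of _ a] exI[of _ p] exI[of _ q]) auto
    then show ?L ..
  qed
qed

lemma contains_2431_or_4231:
  assumes "inj \<pi>"
  shows "contains_pattern n \<pi> [2,4,3,1] \<or> contains_pattern n \<pi> [4,2,3,1] \<longleftrightarrow>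
    (\<exists>a b p q. 1 \<le> a \<and> 1 \<le> b \<and> a < p \<and> b < p \<and> p < q \<and> q \<le> n \<and> \<pi> q < \<pi> a \<and> \<pi> a < \<pi> p \<and> \<pi> p < \<pi> b)"
    (is "?L = ?R")
proof
  have ne: "\<pi> x = \<pi> y \<longleftrightarrow> x = y" for x y using assms by (simp add: inj_eq)
  assume ?L
  then show ?R
  proof
    assume "contains_pattern n \<pi> [2,4,3,1]"
    then obtain a b c d where "1 \<le> a" "a < b" "b < c" "c < d" "d \<le> n"
      "\<pi> a < \<pi> b" "\<pi> a < \<pi> c" "\<not> \<pi> a < \<pi> d" "\<not> \<pi> b < \<pi> c" "\<not> \<pi> b < \<pi> d" "\<not> \<pi> c < \<pi> d"
      unfolding contains_pattern_4 by auto
    then show ?R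
      using ne[of c b] ne[of d a]
      by (intro exI[of _ a] exI[of _ b] exI[of _ c] exI[of _ d]) auto
  next
    assume "contains_pattern n \<pi> [4,2,3,1]"
    then obtain a b c d where "1 \<le> a" "a < b" "b < c" "c < d" "d \<le> n"
      "\<not> \<pi> a < \<pi> b" "\<not> \<pi> a < \<pi> c" "\<not> \<pi> a < \<pi> d" "\<pi> b < \<pi> c" "\<not> \<pi> b < \<pi> d" "\<not> \<pi> c < \<pi> d"
      unfolding contains_pattern_4 by auto
    then show ?R
      using ne[of c a] ne[of d b]
      by (intro exI[of _ b] exI[of _ a] exI[of _ c] exI[of _ d]) auto
  qed
next
  assume ?R
  then obtain a b p q where R: "1 \<le> a" "1 \<le> b" "a < p" "b < p" "p < q" "q \<le> n"
    "\<pi> q < \<pi> a" "\<pi> a < \<pi> p" "\<pi> p < \<pi> b" by blast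
  then consider "a < b" | "b < a" by (metis less_trans linorder_neqE_nat less_irrefl)
  then show ?L
  proof cases
    case 1
    then have "contains_pattern n \<pi> [2,4,3,1]"
      unfolding contains_pattern_4 using R
      by (intro exI[of _ a] exI[of _ b] exI[of _ p] exI[of _ q]) auto
    then show ?L ..
  next
    case 2
    then have "contains_pattern n \<pi> [4,2,3,1]"
      unfolding contains_pattern_4 using R
      by (intro exI[of _ b] exI[of _ a] exI[of _ p] exI[of _ q]) auto
    then show ?L ..
  qed
qed

text \<open>
  Passes between positions and prefixes: with \<open>k + 1\<close> the third position of a pattern, the first two
  entries are used values and the fourth entry is an unused one. Conversely, an
  unused value below a used one does occur at a later position. Positivity of \<open>s\<close> and \<open>t\<close> keeps
  the auxiliary position 0 out of the pattern.
\<close>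

lemma rule_violation_iff:
  fixes B :: "nat \<Rightarrow> nat \<Rightarrow> nat \<Rightarrow> nat \<Rightarrow> bool"
  assumes \<pi>: "\<pi> permutes {1..n}"
    and B: "\<And>v s y t. B v s y t \<Longrightarrow> 0 < s \<and> 0 < t \<and> y < t \<and> y \<noteq> v"
  shows "(\<exists>a b p q. 1 \<le> a \<and> 1 \<le> b \<and> a < p \<and> b < p \<and> p < q \<and> q \<le> n \<and> B (\<pi> p) (\<pi> a) (\<pi> q) (\<pi> b)) \<longleftrightarrow>
    (\<exists>k<n. \<exists>s\<in>\<pi> ` {..k}. \<exists>t\<in>\<pi> ` {..k}. \<exists>y. y \<notin> \<pi> ` {..k} \<and> B (\<pi> (Suc k)) s y t)"
    (is "?L \<longleftrightarrow> ?R")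
proof
  have inj: "\<pi> x = \<pi> y \<longleftrightarrow> x = y" for x y using permutes_inj[OF \<pi>] by (simp add: inj_eq)
  assume ?L
  then obtain a b p q where L: "a < p" "b < p" "p < q" "q \<le> n" "B (\<pi> p) (\<pi> a) (\<pi> q) (\<pi> b)"
    by blast
  then obtain k where k: "p = Suc k" by (cases p) auto
  have "\<pi> a \<in> \<pi> ` {..k}" "\<pi> b \<in> \<pi> ` {..k}" "\<pi> q \<notin> \<pi> ` {..k}" using L k by (auto simp: inj)
  moreover have "k < n" using L k by simp
  ultimately show ?R using L k by blast
next
  assume ?R
  then obtain k a b y where R: "k < n" "a \<le> k" "b \<le> k" "y \<notin> \<pi> ` {..k}" "B (\<pi> (Suc k)) (\<pi> a) y (\<pi> b)"
    by auto
  have perm: "\<pi> permutes {..n}"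
    using \<pi> by (rule permutes_subset) auto
  then have "\<pi> b \<le> n"
    using permutes_in_image[OF perm, of b] R by simp
  then have "y \<in> \<pi> ` {..n}"
    using B[OF R(5)] permutes_image[OF perm] by simp
  then obtain q where q: "q \<le> n" "\<pi> q = y" by auto
  have "k < q" using R(4) q(2) by (meson atMost_iff imageI not_le_imp_less)
  moreover have "q \<noteq> Suc k" using B[OF R(5)] q(2) by auto
  moreover have "a \<noteq> 0" "b \<noteq> 0"
    using B[OF R(5)] permutes_zero[OF \<pi>] by (auto intro!: gr0I)
  ultimately show ?L
    using R q by (intro exI[of _ a] exI[of _ b] exI[of _ "Suc k"] exI[of _ q]) auto
qed

lemma next_value_unused:
  assumes "\<pi> permutes {1..n}"
  shows "\<pi> (Suc k) \<notin> \<pi> ` {..k}"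
  using permutes_inj[OF assms] by (auto simp: inj_eq)

lemma avoiders_2413_4213: "avoiders n ([2,4,1,3], [4,2,1,3]) = rule_perms top_gap_rule n"
proof -
  have "contains_pattern n \<pi> [2,4,1,3] \<or> contains_pattern n \<pi> [4,2,1,3] \<longleftrightarrow>
      (\<exists>k<n. \<not> top_gap_rule (\<pi> ` {..k}) (\<pi> (Suc k)))" if \<pi>: "\<pi> permutes {1..n}" for \<pi>
    unfolding contains_2413_or_4213[OF permutes_inj[OF \<pi>]] top_gap_rule_def
    by (simp only: next_value_unused[OF \<pi>] simp_thms)
      (rule rule_violation_iff[OF \<pi>, where B = "\<lambda>v s y t. v < s \<and> s < y \<and> y < t"], simp)
  then show ?thesis
    unfolding avoiders_def rule_perms_def fst_conv snd_conv by blast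
qed

lemma avoiders_2431_4231: "avoiders n ([2,4,3,1], [4,2,3,1]) = rule_perms bottom_gap_rule n"
proof -
  have "contains_pattern n \<pi> [2,4,3,1] \<or> contains_pattern n \<pi> [4,2,3,1] \<longleftrightarrow>
      (\<exists>k<n. \<not> bottom_gap_rule (\<pi> ` {..k}) (\<pi> (Suc k)))" if \<pi>: "\<pi> permutes {1..n}" for \<pi>
    unfolding contains_2431_or_4231[OF permutes_inj[OF \<pi>]] bottom_gap_rule_def
    by (simp only: next_value_unused[OF \<pi>] simp_thms)
      (rule rule_violation_iff[OF \<pi>, where B = "\<lambda>v s y t. y < s \<and> s < v \<and> v < t"], simp)
  then show ?thesis
    unfolding avoiders_def rule_perms_def fst_conv snd_conv by blast
qed

section \<open>Statistics of the running maxima\<close>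

text \<open>
  Each class of permutations with a given value of the statistic is a disjoint union of classes
  with given running maxima, and those have equal size for the two rules.
\<close>

lemma wilf_equivalent_run_max:
  assumes st: "\<And>n \<pi>. \<pi> permutes {1..n} \<Longrightarrow> st n \<pi> = g n (run_max \<pi>)"
  shows "wilf_equivalent st ([2,4,1,3], [4,2,1,3]) ([2,4,3,1], [4,2,3,1])"
  unfolding wilf_equivalent_def avoiders_2413_4213 avoiders_2431_4231
proof (intro allI impI)
  fix n :: nat and v
  define T where "T = run_max ` {\<pi>. \<pi> permutes {1..n} \<and> st n \<pi> = v}"
  have perms: "finite {\<pi>. \<pi> permutes {1..n}}" by (simp add: finite_permutations)
  then have T: "finite T" by (simp add: T_def)
  have fibres: "card {\<pi> \<in> rule_perms adm n. st n \<pi> = v}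
      = (\<Sum>m\<in>T. card {\<pi> \<in> rule_perms adm n. run_max \<pi> = m})" for adm
  proof -
    have fin: "finite (rule_perms adm n)"
      by (rule finite_subset[OF _ perms]) (auto simp: rule_perms_def)
    have "{\<pi> \<in> rule_perms adm n. st n \<pi> = v} = (\<Union>m\<in>T. {\<pi> \<in> rule_perms adm n. run_max \<pi> = m})"
      unfolding T_def rule_perms_def by (auto simp: st)
    also have "card \<dots> = (\<Sum>m\<in>T. card {\<pi> \<in> rule_perms adm n. run_max \<pi> = m})"
      by (rule card_UN_disjoint) (use T fin in auto)
    finally show ?thesis .
  qed
  show "card {\<pi> \<in> rule_perms top_gap_rule n. st n \<pi> = v}
      = card {\<pi> \<in> rule_perms bottom_gap_rule n. st n \<pi> = v}"
    unfolding fibres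
    by (rule sum.cong)
      (auto simp: T_def intro!: card_rule_perms_run_max gap_filling_top gap_filling_bottom)
qed

lemma wilf_equivalent_sym: "wilf_equivalent st P Q \<Longrightarrow> wilf_equivalent st Q P"
  by (simp add: wilf_equivalent_def)

lemma LMAXP_run_max:
  assumes \<pi>: "\<pi> permutes {1..n}"
  shows "LMAXP n \<pi> = {i \<in> {1..n}. run_max \<pi> (i - 1) < run_max \<pi> i}"
proof -
  have "(\<forall>j. 1 \<le> j \<and> j < i \<longrightarrow> \<pi> j < \<pi> i) \<longleftrightarrow> run_max \<pi> (i - 1) < run_max \<pi> i"
    if i: "i \<in> {1..n}" for i
  proof -
    obtain k where k: "i = Suc k" using i by (cases i) auto
    have pos: "\<pi> 0 < \<pi> i"
      using permutes_in_image[OF \<pi>, of i] i permutes_zero[OF \<pi>] by simp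
    have "run_max \<pi> k < run_max \<pi> (Suc k) \<longleftrightarrow> run_max \<pi> k < \<pi> (Suc k)"
      by (simp add: run_max_Suc less_max_iff_disj)
    also have "\<dots> \<longleftrightarrow> (\<forall>j\<le>k. \<pi> j < \<pi> (Suc k))"
      by (auto simp: run_max_def)
    also have "\<dots> \<longleftrightarrow> (\<forall>j. 1 \<le> j \<and> j < Suc k \<longrightarrow> \<pi> j < \<pi> (Suc k))"
      using pos k by (metis Suc_leI gr0I less_Suc_eq_le One_nat_def)
    finally show ?thesis using k by simp
  qed
  then show ?thesis unfolding LMAXP_def by blast
qed

lemma comps_run_max:
  assumes \<pi>: "\<pi> permutes {1..n}"
  shows "comps n \<pi> = card {i \<in> {1..n}. run_max \<pi> i \<le> i}"
proof -
  have "(\<forall>j\<in>{1..i}. \<pi> j \<le> i) \<longleftrightarrow> run_max \<pi> i \<le> i" for i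
  proof -
    have "run_max \<pi> i \<le> i \<longleftrightarrow> (\<forall>j\<in>{..i}. \<pi> j \<le> i)" by (simp add: run_max_def)
    also have "{..i} = insert 0 {1..i}" by auto
    finally show ?thesis using permutes_zero[OF \<pi>] by simp
  qed
  then show ?thesis by (simp add: comps_def)
qed

definition iar_of_LMAXP :: "nat \<Rightarrow> nat set \<Rightarrow> nat" where
  "iar_of_LMAXP n L =
     (if \<exists>i\<in>{1..n - 1}. i + 1 \<notin> L then LEAST i. i \<in> {1..n - 1} \<and> i + 1 \<notin> L else n)"

text \<open>
  A descent at \<open>i\<close> means that \<open>i + 1\<close> is no left-to-right maximum. Conversely, if \<open>i + 1\<close> is no
  left-to-right maximum then there is a descent at \<open>i\<close> or earlier, because
  otherwise the values would increase up to position \<open>i + 1\<close>. So the least positions agree.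
\<close>

lemma iar_LMAXP:
  assumes \<pi>: "\<pi> permutes {1..n}"
  shows "iar n \<pi> = iar_of_LMAXP n (LMAXP n \<pi>)"
proof -
  define D where "D = (\<lambda>i. i \<in> {1..n - 1} \<and> \<pi> i > \<pi> (i + 1))"
  define N where "N = (\<lambda>i. i \<in> {1..n - 1} \<and> i + 1 \<notin> LMAXP n \<pi>)"
  have DN: "N i" if "D i" for i
    using that unfolding D_def N_def LMAXP_def by force
  have ND: "\<exists>i'\<le>i. D i'" if "N i" for i
  proof (rule ccontr)
    assume no: "\<not> ?thesis"
    have asc: "\<pi> l < \<pi> (Suc l)" if "1 \<le> l" "l \<le> i" for l
    proof -
      have "\<pi> l \<noteq> \<pi> (Suc l)" using permutes_inj[OF \<pi>] by (simp add: inj_eq)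
      moreover have "\<not> \<pi> (Suc l) < \<pi> l" using no that \<open>N i\<close> by (auto simp: D_def N_def)
      ultimately show ?thesis by simp
    qed
    have "\<pi> j < \<pi> (i + 1)" if "1 \<le> j" "j < i + 1" for j
    proof -
      have "Suc j \<le> i + 1" using that by simp
      then show ?thesis
      proof (induction rule: dec_induct)
        case base
        then show ?case using asc that by simp
      next
        case (step l)
        then show ?case using asc[of l] that by simp
      qed
    qed
    then have "i + 1 \<in> LMAXP n \<pi>" using \<open>N i\<close> by (auto simp: LMAXP_def N_def)
    then show False using \<open>N i\<close> by (simp add: N_def)
  qed
  have ex: "(\<exists>i. D i) \<longleftrightarrow> (\<exists>i. N i)" using DN ND by blast
  have "(LEAST i. D i) = (LEAST i. N i)" if "\<exists>i. D i"
  proof (rule antisym)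
    have "\<exists>i. N i" using that ex by simp
    from ND[OF LeastI_ex[OF this]] obtain i where "i \<le> (LEAST i. N i)" "D i" by blast
    then show "(LEAST i. D i) \<le> (LEAST i. N i)" by (meson Least_le order_trans)
    show "(LEAST i. N i) \<le> (LEAST i. D i)"
      using DN LeastI_ex[OF that] by (intro Least_le)
  qed
  then have "(if \<exists>i. D i then LEAST i. D i else n) = (if \<exists>i. N i then LEAST i. N i else n)"
    using ex by simp
  then show ?thesis
    unfolding iar_def iar_of_LMAXP_def D_def N_def Bex_def .
qed

theorem theorem5p9:
  shows "wilf_equivalent (\<lambda>n \<pi>. (LMAXP n \<pi>, comps n \<pi>))
           ([2,4,1,3], [4,2,1,3]) ([2,4,3,1], [4,2,3,1])
       \<and> wilf_equivalent (\<lambda>n \<pi>. (lmax n \<pi>, iar n \<pi>, comps n \<pi>))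
           ([2,4,1,3], [4,2,1,3]) ([2,4,3,1], [4,2,3,1])
       \<and> wilf_equivalent iar ([2,4,3,1], [4,2,3,1]) ([2,4,1,3], [4,2,1,3])
       \<and> wilf_equivalent (\<lambda>n \<pi>. (iar n \<pi>, comps n \<pi>))
           ([2,4,3,1], [4,2,3,1]) ([2,4,1,3], [4,2,1,3])"
proof -
  define L where "L = (\<lambda>(n::nat) m. {i \<in> {1..n}. m (i - 1) < (m i :: nat)})"
  define c where "c = (\<lambda>(n::nat) m. card {i \<in> {1..n}. m i \<le> (i :: nat)})"
  have L: "LMAXP n \<pi> = L n (run_max \<pi>)" and c: "comps n \<pi> = c n (run_max \<pi>)"
    if "\<pi> permutes {1..n}" for n \<pi>
    using LMAXP_run_max[OF that] comps_run_max[OF that] by (simp_all add: L_def c_def)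
  show ?thesis
    by (intro conjI wilf_equivalent_sym[of _ "([2,4,1,3], [4,2,1,3])"]
          wilf_equivalent_run_max[where g = "\<lambda>n m. (L n m, c n m)"]
          wilf_equivalent_run_max[where g = "\<lambda>n m. (card (L n m), iar_of_LMAXP n (L n m), c n m)"]
          wilf_equivalent_run_max[where g = "\<lambda>n m. iar_of_LMAXP n (L n m)"]
          wilf_equivalent_run_max[where g = "\<lambda>n m. (iar_of_LMAXP n (L n m), c n m)"])
      (simp_all add: lmax_def iar_LMAXP L c)
qed

end
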